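(* Let $n$ be a positive integer. The poset $S\text{-}Block(n)\cup\{\hat 0,\hat 1\}$, obtained from $S\text{-}Block(n)$ by adding a new minimum element $\hat 0$ and a new maximum element $\hat 1$, is a lattice. If $[\alpha_1|\beta_1]$ and $[\alpha_2|\beta_2]$ are $S$-blocks in $S\text{-}Block(n)$ and $\ell=\max\{\mathrm{len}(\alpha_1)-\mathrm{len}(\beta_2),\ \mathrm{len}(\alpha_2)-\mathrm{len}(\beta_1)\}$, then the meet and join of $[\alpha_1|\beta_1]$ and $[\alpha_2|\beta_2]$ are given as follows. (i) If $\ell=0$ or $\ell=1$, then $[\alpha_1|\beta_1]\wedge[\alpha_2|\beta_2]=[\alpha_1\wedge\alpha_2\,|\,\beta_1\vee\beta_2]$, which is an $S$-block. Otherwise, $[\alpha_1|\beta_1]\wedge[\alpha_2|\beta_2]=\hat 0$. (ii) If $(\beta_1\wedge\beta_2)\succeq(\alpha_1\vee\alpha_2)$, then $[\alpha_1|\beta_1]\vee[\alpha_2|\beta_2]=[\alpha_1\vee\alpha_2\,|\,\beta_1\wedge\beta_2]$, which is an $S$-block. Otherwise, $[\alpha_1|\beta_1]\vee[\alpha_2|\beta_2]=\hat 1$.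
   Context: $Dis(n)$ is the set of partitions $\gamma=(g_1,\dots,g_r)$ of $n$ into distinct positive parts $g_1>\dots>g_r>0$, with $\mathrm{len}(\gamma)=r$. For $\gamma=(g_1,\dots,g_r)$ and $\delta=(d_1,\dots,d_s)$ in $Dis(n)$, $\delta\succeq\gamma$ ($\delta$ majorizes $\gamma$) means $\sum_{i=1}^m d_i\ge\sum_{i=1}^m g_i$ for all $m\le\min\{r,s\}$. The poset $Dis(n)$ is known to be a lattice (Le and Phan); for $\gamma,\delta\in Dis(n)$, $\gamma\wedge\delta$ and $\gamma\vee\delta$ denote meet and join in $Dis(n)$. An $S$-block is an ordered pair $[\alpha|\beta]$ with $\alpha,\beta\in Dis(n)$, $\beta\succeq\alpha$, and $\mathrm{len}(\alpha)\in\{\mathrm{len}(\beta),\mathrm{len}(\beta)+1\}$. $S\text{-}Block(n)$ is the poset of all such $S$-blocks, ordered by $[\alpha_1|\beta_1]\succeq[\alpha_2|\beta_2]$ iff $\alpha_1\succeq\alpha_2$ and $\beta_1\preceq\beta_2$. *)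

theory Defs
  imports "HOL-Algebra.Lattice"
begin

text \<open>A partition is the list of its parts in strictly decreasing order, so \<open>len\<close> is \<^const>\<open>length\<close>.\<close>

definition distinct_partitions :: "nat \<Rightarrow> nat list set" where
  "distinct_partitions n = {xs. sorted_wrt (>) xs \<and> (\<forall>x\<in>set xs. 0 < x) \<and> sum_list xs = n}"

definition majorizes :: "nat list \<Rightarrow> nat list \<Rightarrow> bool"  (infix \<open>\<succeq>\<close> 50) where
  "ds \<succeq> gs \<longleftrightarrow>
     (\<forall>m \<le> min (length gs) (length ds). sum_list (take m ds) \<ge> sum_list (take m gs))"

definition Dis :: "nat \<Rightarrow> nat list gorder" where
  "Dis n = \<lparr> carrier = distinct_partitions n, eq = (=), le = (\<lambda>gs ds. ds \<succeq> gs) \<rparr>"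

text \<open>The pair \<open>(a, b)\<close> stands for the block \<open>[a|b]\<close>.\<close>

definition S_blocks :: "nat \<Rightarrow> (nat list \<times> nat list) set" where
  "S_blocks n =
     {(a, b). a \<in> distinct_partitions n \<and> b \<in> distinct_partitions n \<and> b \<succeq> a \<and>
              length a \<in> {length b, length b + 1}}"

definition S_Block :: "nat \<Rightarrow> (nat list \<times> nat list) gorder" where
  "S_Block n =
     \<lparr> carrier = S_blocks n, eq = (=),
       le = (\<lambda>(a2, b2) (a1, b1). a1 \<succeq> a2 \<and> b2 \<succeq> b1) \<rparr>"

datatype 'a hat = Zero_hat | Elem 'a | One_hat

fun hat_le :: "('a \<Rightarrow> 'a \<Rightarrow> bool) \<Rightarrow> 'a hat \<Rightarrow> 'a hat \<Rightarrow> bool" where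
  "hat_le r Zero_hat y = True"
| "hat_le r (Elem x) Zero_hat = False"
| "hat_le r (Elem x) (Elem y) = r x y"
| "hat_le r (Elem x) One_hat = True"
| "hat_le r One_hat y = (y = One_hat)"

definition add_hats :: "'a gorder \<Rightarrow> 'a hat gorder" where
  "add_hats P =
     \<lparr> carrier = {Zero_hat, One_hat} \<union> Elem ` carrier P, eq = (=), le = hat_le (le P) \<rparr>"

end

theory Submission
  imports Defs
begin

text \<open>
  A partition \<open>x\<close> of \<open>n\<close> is determined by its partial sums
  \<open>X m = x\<^sub>1 + \<dots> + x\<^sub>m\<close>, taken for all \<open>m\<close> by letting the sequence stay at \<open>n\<close> beyond
  the last part. The parts are distinct exactly if \<open>X\<close> is strictly concave until it has reached \<open>n\<close>
  (\<open>psum_concave\<close>, \<open>partial_sums_realized\<close>), and majorization is the pointwise order on these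
  sequences (\<open>majorizes_iff_psum\<close>). A pointwise infimum of strictly concave sequences is strictly
  concave, so every nonempty set of distinct partitions has a greatest lower bound
  (\<open>greatest_lower_bound\<close>), and joins are greatest lower bounds of sets of upper bounds.

  The formulas for blocks rest on the lengths of meets and joins. The length is the time at which the
  partial sums reach \<open>n\<close>, so it is antitone, and a meet has the larger of the two lengths. A join
  has the smaller of the two lengths, \<open>r\<close> say: it cannot be longer because it majorizes both
  partitions. It cannot be shorter because the staircase partition
  \<open>(n - r(r-1)/2, r-1, \<dots>, 2, 1)\<close> majorizes every partition with at least \<open>r\<close> parts
  (\<open>staircase\<close>); it is thus an upper bound with \<open>r\<close> parts, and it majorizes the join.

  It remains to decide when the componentwise meet and join of two blocks are blocks. The pair \<open>[\<alpha>\<^sub>1 \<sqinter> \<alpha>\<^sub>2 | \<beta>\<^sub>1 \<squnion> \<beta>\<^sub>2]\<close>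
  is always ordered correctly, and the difference of its lengths is the largest of the four
  differences \<open>len \<alpha>\<^sub>i - len \<beta>\<^sub>j\<close>. If that exceeds 1, a common lower bound of the two
  blocks would have at least this difference, so none exists. The pair
  \<open>[\<alpha>\<^sub>1 \<squnion> \<alpha>\<^sub>2 | \<beta>\<^sub>1 \<sqinter> \<beta>\<^sub>2]\<close> always has length difference at most 1, since
  this is the smallest of the four differences. If it is ordered correctly then the difference is also
  nonnegative. If it is not, no common upper bound \<open>[a | b]\<close> exists, because
  \<open>\<beta>\<^sub>1 \<sqinter> \<beta>\<^sub>2 \<succeq> b \<succeq> a \<succeq> \<alpha>\<^sub>1 \<squnion> \<alpha>\<^sub>2\<close>. The new bottom and top elements
  supply the missing bounds (\<open>lattice_add_hats\<close>).
\<close>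

section \<open>Greatest lower and least upper bounds of pairs\<close>

lemma Lower_pair:
  assumes "x \<in> carrier L" "y \<in> carrier L"
  shows "Lower L {x, y} = {z \<in> carrier L. z \<sqsubseteq>\<^bsub>L\<^esub> x \<and> z \<sqsubseteq>\<^bsub>L\<^esub> y}"
  using assms by (auto simp: Lower_def)

lemma Upper_pair:
  assumes "x \<in> carrier L" "y \<in> carrier L"
  shows "Upper L {x, y} = {z \<in> carrier L. x \<sqsubseteq>\<^bsub>L\<^esub> z \<and> y \<sqsubseteq>\<^bsub>L\<^esub> z}"
  using assms by (auto simp: Upper_def)

lemma greatest_Lower_pair:
  assumes "x \<in> carrier L" "y \<in> carrier L"
  shows "greatest L m (Lower L {x, y}) \<longleftrightarrow> m \<in> carrier L \<and> m \<sqsubseteq>\<^bsub>L\<^esub> x \<and> m \<sqsubseteq>\<^bsub>L\<^esub> y \<and>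
    (\<forall>z\<in>carrier L. z \<sqsubseteq>\<^bsub>L\<^esub> x \<longrightarrow> z \<sqsubseteq>\<^bsub>L\<^esub> y \<longrightarrow> z \<sqsubseteq>\<^bsub>L\<^esub> m)"
  unfolding greatest_def Lower_pair[OF assms] by auto

lemma least_Upper_pair:
  assumes "x \<in> carrier L" "y \<in> carrier L"
  shows "least L j (Upper L {x, y}) \<longleftrightarrow> j \<in> carrier L \<and> x \<sqsubseteq>\<^bsub>L\<^esub> j \<and> y \<sqsubseteq>\<^bsub>L\<^esub> j \<and>
    (\<forall>z\<in>carrier L. x \<sqsubseteq>\<^bsub>L\<^esub> z \<longrightarrow> y \<sqsubseteq>\<^bsub>L\<^esub> z \<longrightarrow> j \<sqsubseteq>\<^bsub>L\<^esub> z)"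
  unfolding least_def Upper_pair[OF assms] by auto

lemma (in partial_order) meet_eqI:
  assumes "greatest L m (Lower L {x, y})"
  shows "x \<sqinter> y = m"
  unfolding meet_def inf_def using assms greatest_unique by blast

lemma (in partial_order) join_eqI:
  assumes "least L j (Upper L {x, y})"
  shows "x \<squnion> y = j"
  unfolding join_def sup_def using assms least_unique by blast

section \<open>Partial sums of distinct partitions\<close>

abbreviation psum :: "nat list \<Rightarrow> nat \<Rightarrow> nat" where
  "psum xs m \<equiv> sum_list (take m xs)"

lemma psum_Suc:
  "psum xs (Suc m) = psum xs m + (if m < length xs then xs ! m else 0)"
  by (simp add: take_Suc_conv_app_nth)

lemma psum_le_Suc: "psum xs m \<le> psum xs (Suc m)"
  by (simp add: psum_Suc)

lemma psum_le:
  assumes "xs \<in> distinct_partitions n"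
  shows "psum xs m \<le> n"
proof -
  have "psum xs m + sum_list (drop m xs) = n"
    using assms by (simp add: distinct_partitions_def flip: sum_list_append)
  then show ?thesis by simp
qed

text \<open>This makes the length of a partition readable off its partial sums, without reference to the parts.\<close>

lemma psum_eq_iff:
  assumes "xs \<in> distinct_partitions n"
  shows "psum xs m = n \<longleftrightarrow> length xs \<le> m"
proof -
  have split: "psum xs m + sum_list (drop m xs) = n"
    using assms by (simp add: distinct_partitions_def flip: sum_list_append)
  have "\<forall>x\<in>set (drop m xs). 0 < x"
    using assms by (auto simp: distinct_partitions_def dest: in_set_dropD)
  then have "sum_list (drop m xs) = 0 \<longleftrightarrow> length xs \<le> m"
    by (cases "drop m xs") (auto dest: arg_cong[where f = length])
  with split show ?thesis by linarith
qed

lemma psum_strict: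
  assumes "xs \<in> distinct_partitions n" "psum xs m < n"
  shows "psum xs m < psum xs (Suc m)"
proof -
  have "m < length xs"
    using assms psum_eq_iff[OF assms(1), of m] by linarith
  then show ?thesis
    using assms(1) by (auto simp: psum_Suc distinct_partitions_def)
qed

text \<open>The drop from one part to the next is at least 1. This includes the drop from the last part to the
  zero that \<open>psum_Suc\<close> supplies behind it, because parts are positive. After that point the
  sequence is constant, which is why the hypothesis \<open>psum xs m < n\<close> cannot be omitted.\<close>

lemma psum_concave:
  assumes "xs \<in> distinct_partitions n" "psum xs m < n"
  shows "psum xs m + psum xs (Suc (Suc m)) < 2 * psum xs (Suc m)"
proof -
  have m: "m < length xs"
    using assms psum_eq_iff[OF assms(1), of m] by linarith
  have "xs ! Suc m < xs ! m" if "Suc m < length xs"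
    using assms(1) that by (auto simp: distinct_partitions_def sorted_wrt_iff_nth_less)
  moreover have "0 < xs ! m"
    using assms(1) m by (auto simp: distinct_partitions_def)
  ultimately show ?thesis
    using m by (simp add: psum_Suc)
qed

lemma psum_inject:
  assumes "xs \<in> distinct_partitions n" "ys \<in> distinct_partitions n"
    and eq: "\<And>m. psum xs m = psum ys m"
  shows "xs = ys"
proof (rule nth_equalityI)
  show len: "length xs = length ys"
    using psum_eq_iff[OF assms(1)] psum_eq_iff[OF assms(2)] eq by (metis le_antisym order_refl)
  show "xs ! i = ys ! i" if "i < length xs" for i
    using eq[of i] eq[of "Suc i"] that len by (simp add: psum_Suc)
qed

text \<open>The converse of \<open>psum_le\<close>, \<open>psum_strict\<close> and \<open>psum_concave\<close>: the increments of \<open>F\<close>, up to the first time \<open>r\<close> at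
  which \<open>F\<close> reaches \<open>n\<close>, are the parts.\<close>

lemma partial_sums_realized:
  fixes F :: "nat \<Rightarrow> nat"
  assumes zero: "F 0 = 0"
    and le: "\<And>m. F m \<le> n"
    and mono: "\<And>m. F m \<le> F (Suc m)"
    and strict: "\<And>m. F m < n \<Longrightarrow> F m < F (Suc m)"
    and concave: "\<And>m. F m < n \<Longrightarrow> F m + F (Suc (Suc m)) < 2 * F (Suc m)"
  obtains xs where "xs \<in> distinct_partitions n" "\<And>m. psum xs m = F m"
proof -
  \<comment> \<open>Strict growth below \<open>n\<close> forces \<open>F\<close> to reach \<open>n\<close> after at most \<open>n\<close> steps.\<close>
  have "min m n \<le> F m" for m
  proof (induction m)
    case (Suc m)
    then show ?case using strict[of m] mono[of m] le[of m] by (cases "F m < n") auto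
  qed (simp add: zero)
  from this[of n] le[of n] have ex: "\<exists>r. F r = n" by (auto intro: exI[of _ n])
  define r where "r = (LEAST r. F r = n)"
  have Fr: "F r = n" unfolding r_def by (rule LeastI_ex[OF ex])
  have below: "F m < n" if "m < r" for m
    using not_less_Least[of m "\<lambda>r. F r = n"] that le[of m] by (auto simp: r_def)
  have above: "F m = n" if "r \<le> m" for m
    using lift_Suc_mono_le[of F r m] mono that Fr le[of m] by auto
  define xs where "xs = map (\<lambda>i. F (Suc i) - F i) [0..<r]"
  have initial: "sum_list (map (\<lambda>i. F (Suc i) - F i) [0..<k]) = F k" for k
    by (induction k) (use mono zero in auto)
  have psum: "psum xs m = F m" for m
  proof -
    have "psum xs m = F (min m r)"
      by (simp add: xs_def take_map take_upt initial min_def)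
    then show ?thesis using above[of m] Fr by (auto simp: min_def)
  qed
  have dec: "F (Suc (Suc i)) - F (Suc i) < F (Suc i) - F i" if "Suc i < r" for i
    using concave[of i] below[of i] mono[of i] mono[of "Suc i"] that by simp
  have "sorted_wrt (>) xs"
    by (subst sorted_wrt_iff_nth_Suc_transp) (auto simp: xs_def dec transp_on_def)
  moreover have "\<forall>x\<in>set xs. 0 < x"
    using strict below by (auto simp: xs_def)
  moreover have "sum_list xs = n"
    by (simp add: xs_def initial Fr)
  ultimately have "xs \<in> distinct_partitions n"
    by (simp add: distinct_partitions_def)
  then show thesis using psum that by blast
qed

section \<open>Majorization as the pointwise order of partial sums\<close>

text \<open>The definition compares partial sums only up to the smaller length. Nothing is lost: if \<open>ds\<close> were
  longer than \<open>gs\<close>, its first \<open>length gs\<close> parts would already sum to \<open>n\<close>, which is impossible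
  for positive parts. So \<open>ds\<close> is not longer, and beyond its last part its partial sums are \<open>n\<close>.\<close>

lemma majorizes_iff_psum:
  assumes "gs \<in> distinct_partitions n" "ds \<in> distinct_partitions n"
  shows "ds \<succeq> gs \<longleftrightarrow> (\<forall>m. psum gs m \<le> psum ds m)"
proof
  assume maj: "ds \<succeq> gs"
  let ?k = "min (length gs) (length ds)"
  have full: "psum ds m = n" if "?k \<le> m" for m
  proof (cases "length ds \<le> length gs")
    case True
    with that have "length ds \<le> m" by simp
    then show ?thesis using psum_eq_iff[OF assms(2)] by blast
  next
    case False
    \<comment> \<open>This case is contradictory, but the claim follows from the length criterion all the same.\<close>
    have "length gs \<le> ?k" using False by simp
    then have "psum gs (length gs) \<le> psum ds (length gs)"
      using maj unfolding majorizes_def by blast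
    moreover have "psum gs (length gs) = n"
      using psum_eq_iff[OF assms(1)] by blast
    ultimately have "psum ds (length gs) = n"
      using psum_le[OF assms(2), of "length gs"] by linarith
    with False show ?thesis using psum_eq_iff[OF assms(2)] by blast
  qed
  show "\<forall>m. psum gs m \<le> psum ds m"
  proof
    fix m
    show "psum gs m \<le> psum ds m"
      using maj full[of m] psum_le[OF assms(1), of m]
      by (cases "m \<le> ?k") (auto simp: majorizes_def)
  qed
qed (simp add: majorizes_def)

text \<open>The larger sequence of partial sums reaches \<open>n\<close> no later than the smaller one.\<close>

lemma majorizes_length:
  assumes "gs \<in> distinct_partitions n" "ds \<in> distinct_partitions n" "ds \<succeq> gs"
  shows "length ds \<le> length gs"
proof -
  have "n \<le> psum ds (length gs)"
    using assms majorizes_iff_psum[OF assms(1,2)] psum_eq_iff[OF assms(1), of "length gs"]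
    by (metis order_refl)
  then show ?thesis
    using psum_le[OF assms(2), of "length gs"] psum_eq_iff[OF assms(2)] by (metis le_antisym)
qed

lemma majorizes_trans:
  assumes "as \<in> distinct_partitions n" "bs \<in> distinct_partitions n" "cs \<in> distinct_partitions n"
    and "cs \<succeq> bs" "bs \<succeq> as"
  shows "cs \<succeq> as"
  using assms majorizes_iff_psum by (meson order_trans)

lemma partial_order_Dis: "partial_order (Dis n)"
proof
  show "x .=\<^bsub>Dis n\<^esub> y"
    if "x \<sqsubseteq>\<^bsub>Dis n\<^esub> y" "y \<sqsubseteq>\<^bsub>Dis n\<^esub> x" "x \<in> carrier (Dis n)" "y \<in> carrier (Dis n)" for x y
    using that psum_inject[of x n y] by (simp add: Dis_def majorizes_iff_psum le_antisym)
  show "x \<sqsubseteq>\<^bsub>Dis n\<^esub> x" for x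
    by (simp add: Dis_def majorizes_def)
  show "x \<sqsubseteq>\<^bsub>Dis n\<^esub> z"
    if "x \<sqsubseteq>\<^bsub>Dis n\<^esub> y" "y \<sqsubseteq>\<^bsub>Dis n\<^esub> z"
      "x \<in> carrier (Dis n)" "y \<in> carrier (Dis n)" "z \<in> carrier (Dis n)" for x y z
    using that majorizes_trans[of x n y z] by (simp add: Dis_def)
qed (auto simp: Dis_def)

section \<open>Meets and joins of distinct partitions\<close>

text \<open>Each value \<open>F (m + 1)\<close> of the infimum \<open>F\<close> is attained by some \<open>x \<in> A\<close>, and strict concavity
  of \<open>F\<close> at \<open>m + 1\<close> is inherited from this \<open>x\<close>, because \<open>F\<close> lies below \<open>x\<close> at the
  neighbours \<open>m\<close> and \<open>m + 2\<close>. The exception is an \<open>x\<close> whose sums have already reached \<open>n\<close> at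
  \<open>m\<close>: there \<open>F (m + 1) = n\<close>, and the inequalities hold because \<open>F m < n\<close>.\<close>

lemma pointwise_infimum:
  assumes "A \<subseteq> distinct_partitions n" "A \<noteq> {}"
  obtains g where "g \<in> distinct_partitions n" "\<And>m. psum g m = (INF x\<in>A. psum x m)"
proof -
  define F where "F m = (INF x\<in>A. psum x m)" for m
  have attained: "\<exists>x\<in>A. F m = psum x m" for m
    using Inf_nat_def1[of "(\<lambda>x. psum x m) ` A"] assms(2) by (auto simp: F_def)
  have lower: "F m \<le> psum x m" if "x \<in> A" for m x
    unfolding F_def by (rule cINF_lower) (use that in auto)
  have A: "x \<in> distinct_partitions n" if "x \<in> A" for x
    using that assms(1) by blast
  show thesis
  proof (rule partial_sums_realized[of F n])
    show "F 0 = 0" using attained[of 0] by auto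
    show "F m \<le> n" for m using attained[of m] psum_le A by metis
    show "F m \<le> F (Suc m)" for m
    proof -
      obtain x where x: "x \<in> A" "F (Suc m) = psum x (Suc m)"
        using attained by blast
      show ?thesis
        using lower[OF x(1), of m] psum_le_Suc[of m x] x(2) by linarith
    qed
    show "F m < F (Suc m)" if "F m < n" for m
    proof -
      obtain x where x: "x \<in> A" "F (Suc m) = psum x (Suc m)"
        using attained by blast
      show ?thesis
        using psum_strict[OF A[OF x(1)], of m] psum_le_Suc[of m x] psum_le[OF A[OF x(1)], of "Suc m"]
          lower[OF x(1), of m] that x(2) by linarith
    qed
    show "F m + F (Suc (Suc m)) < 2 * F (Suc m)" if "F m < n" for m
    proof -
      obtain x where x: "x \<in> A" "F (Suc m) = psum x (Suc m)"
        using attained by blast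
      note x_le = psum_le[OF A[OF x(1)]]
      show ?thesis
        using psum_concave[OF A[OF x(1)], of m] psum_le_Suc[of m x] x_le[of m] x_le[of "Suc m"]
          x_le[of "Suc (Suc m)"] lower[OF x(1), of m] lower[OF x(1), of "Suc (Suc m)"] that x(2)
        by linarith
    qed
  qed (use that F_def in auto)
qed

text \<open>The length clause, for \<open>A = {c, d}\<close>, is the upper estimate for the length of a meet. The set
  \<open>A\<close> is arbitrary so that joins can be obtained as greatest lower bounds of all upper bounds.\<close>

lemma greatest_lower_bound:
  assumes "A \<subseteq> distinct_partitions n" "A \<noteq> {}"
  obtains g where "greatest (Dis n) g (Lower (Dis n) A)"
    "\<And>k. (\<And>x. x \<in> A \<Longrightarrow> length x \<le> k) \<Longrightarrow> length g \<le> k"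
proof -
  obtain g where g: "g \<in> distinct_partitions n" "\<And>m. psum g m = (INF x\<in>A. psum x m)"
    using pointwise_infimum[OF assms] by blast
  have "greatest (Dis n) g (Lower (Dis n) A)"
  proof (rule greatest_LowerI)
    show "g \<sqsubseteq>\<^bsub>Dis n\<^esub> x" if "x \<in> A" for x
    proof -
      have "psum g m \<le> psum x m" for m
        unfolding g(2) by (rule cINF_lower) (use that in auto)
      then show ?thesis using g(1) that assms(1) majorizes_iff_psum[of g n x] by (auto simp: Dis_def)
    qed
    show "y \<sqsubseteq>\<^bsub>Dis n\<^esub> g" if "y \<in> Lower (Dis n) A" for y
    proof -
      have y: "y \<in> distinct_partitions n" "\<And>x. x \<in> A \<Longrightarrow> x \<succeq> y"
        using that assms(1) by (auto simp: Lower_def Dis_def)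
      have "psum y m \<le> psum g m" for m
        unfolding g(2)
        by (rule cINF_greatest) (use assms y majorizes_iff_psum[of y n] in auto)
      then show ?thesis using g(1) y(1) majorizes_iff_psum[of y n g] by (simp add: Dis_def)
    qed
  qed (use assms g in \<open>auto simp: Dis_def\<close>)
  moreover have "length g \<le> k" if "\<And>x. x \<in> A \<Longrightarrow> length x \<le> k" for k
  proof -
    have "psum x k = n" if "x \<in> A" for x
      using that \<open>\<And>x. x \<in> A \<Longrightarrow> length x \<le> k\<close> assms(1) psum_eq_iff by blast
    then have "psum g k = n" using assms(2) by (simp add: g(2))
    then show ?thesis using psum_eq_iff[OF g(1)] by blast
  qed
  ultimately show thesis using that by blast
qed

text \<open>A strictly decreasing list of positive numbers dominates the list \<open>(k, \<dots>, 2, 1)\<close> of the same length.\<close>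

lemma triangular_le_sum_list:
  assumes "sorted_wrt (>) xs" "\<forall>x\<in>set xs. (0::nat) < x"
  shows "\<Sum>{..length xs} \<le> sum_list xs"
  using assms
proof (induction xs)
  case (Cons a xs)
  have "set (a # xs) \<subseteq> {1..a}"
    using Cons.prems by (auto simp: less_imp_le Suc_le_eq)
  moreover have "sorted_wrt (<) (rev (a # xs))"
    using Cons.prems(1) by (simp only: sorted_wrt_rev)
  then have "distinct (rev (a # xs))"
    by (simp only: strict_sorted_iff)
  ultimately have "Suc (length xs) \<le> a"
    using card_mono[of "{1..a}" "set (a # xs)"] distinct_card[of "a # xs"]
    by (simp only: distinct_rev finite_atLeastAtMost card_atLeastAtMost) simp
  with Cons show ?case by simp
qed simp

text \<open>Among the partitions with at least \<open>r = length c\<close> parts, the largest is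
  \<open>(n - r(r-1)/2, r-1, \<dots>, 2, 1)\<close>. Behind their first \<open>m\<close> parts, these partitions have at least
  \<open>r - m\<close> further parts, which sum to at least \<open>1 + \<dots> + (r - m)\<close>, and the staircase attains this
  bound for every \<open>m > 0\<close>. The partition \<open>c\<close> witnesses that \<open>n\<close> is large enough for the first
  part of the staircase to exceed \<open>r - 1\<close>.\<close>

lemma staircase:
  assumes "c \<in> distinct_partitions n" "0 < n"
  obtains t where "t \<in> distinct_partitions n" "length t = length c"
    "\<And>x. x \<in> distinct_partitions n \<Longrightarrow> length c \<le> length x \<Longrightarrow> t \<succeq> x"
proof -
  define r where "r = length c"
  have "0 < r" using assms by (auto simp: r_def distinct_partitions_def)
  have tri: "\<Sum>{..r} \<le> n"
    using triangular_le_sum_list[of c] assms(1) by (simp add: r_def distinct_partitions_def)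
  have tri_mono: "\<Sum>{..i} \<le> \<Sum>{..j}" if "i \<le> j" for i j :: nat
    by (rule sum_mono2) (use that in auto)
  \<comment> \<open>For \<open>m > r\<close> the truncated difference \<open>r - m\<close> is 0, so that \<open>F m = n\<close> as desired.\<close>
  define F where "F m = (if m = 0 then 0 else n - \<Sum>{..r - m})" for m
  have F_full: "F m = n" if "r \<le> m" for m
    using that \<open>0 < r\<close> by (simp add: F_def)
  have F_below: "F m < n" if "m < r" for m
  proof -
    have "\<Sum>{..1} \<le> \<Sum>{..r - m}" by (rule tri_mono) (use that in simp)
    then show ?thesis using assms(2) by (auto simp: F_def)
  qed
  have step: "F m < F (Suc m) \<and> F m + F (Suc (Suc m)) < 2 * F (Suc m)" if "m < r" for m
  proof (cases "r - Suc m")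
    case 0
    then show ?thesis using that F_below[of m] F_full[of "Suc m"] F_full[of "Suc (Suc m)"] by simp
  next
    case (Suc j)
    then have r: "r - m = Suc (Suc j)" "r - Suc (Suc m) = j" using that by auto
    have "\<Sum>{..r - m} \<le> n" using order_trans[OF tri_mono tri] by simp
    then show ?thesis by (auto simp: F_def Suc r)
  qed
  have F_less_iff: "F m < n \<longleftrightarrow> m < r" for m
    using F_full[of m] F_below[of m] by (cases "m < r") auto
  obtain t where t: "t \<in> distinct_partitions n" "\<And>m. psum t m = F m"
  proof (rule partial_sums_realized[of F n])
    show "F 0 = 0" "\<And>m. F m \<le> n" by (simp_all add: F_def)
    show "F m \<le> F (Suc m)" for m
      using step[of m] F_full[of m] F_full[of "Suc m"] by (cases "m < r") auto
  qed (use step F_less_iff in auto)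
  have "length t = r"
    using psum_eq_iff[OF t(1)] F_less_iff F_full t(2)
    by (metis le_antisym not_less order_refl)
  moreover have "t \<succeq> x" if x: "x \<in> distinct_partitions n" "r \<le> length x" for x
  proof -
    have "psum x m \<le> F m" if "0 < m" for m
    proof -
      have "\<Sum>{..length x - m} \<le> sum_list (drop m x)"
        using triangular_le_sum_list[of "drop m x"] x(1)
        by (auto simp: distinct_partitions_def sorted_wrt_drop dest: in_set_dropD)
      moreover have "\<Sum>{..r - m} \<le> \<Sum>{..length x - m}"
        using x(2) by (intro tri_mono) simp
      moreover have "psum x m + sum_list (drop m x) = n"
        using x(1) by (simp add: distinct_partitions_def flip: sum_list_append)
      ultimately show ?thesis using that by (simp add: F_def)
    qed
    then have "psum x m \<le> F m" for m by (cases "m = 0") auto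
    then show ?thesis using majorizes_iff_psum[OF x(1) t(1)] t(2) by simp
  qed
  ultimately show thesis using that t(1) by (simp add: r_def)
qed

text \<open>The staircase of length \<open>min (length c) (length d)\<close> is an upper bound of \<open>c\<close> and \<open>d\<close>. It
  shows that the set of upper bounds is nonempty, so that its greatest lower bound exists, and it
  bounds the length of the join from below.\<close>

lemma least_upper_bound:
  assumes "c \<in> distinct_partitions n" "d \<in> distinct_partitions n" "0 < n"
  obtains j where "least (Dis n) j (Upper (Dis n) {c, d})"
    "min (length c) (length d) \<le> length j"
proof -
  let ?U = "Upper (Dis n) {c, d}"
  define s where "s = (if length c \<le> length d then c else d)"
  have s: "s \<in> distinct_partitions n" "length s = min (length c) (length d)"
    using assms by (auto simp: s_def)
  obtain t where t: "t \<in> distinct_partitions n" "length t = length s"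
      "\<And>x. x \<in> distinct_partitions n \<Longrightarrow> length s \<le> length x \<Longrightarrow> t \<succeq> x"
    using staircase[OF s(1) assms(3)] by blast
  have tU: "t \<in> ?U" using assms s t by (auto simp: Upper_def Dis_def)
  have U: "?U \<subseteq> distinct_partitions n" by (auto simp: Upper_def Dis_def)
  obtain j where j: "greatest (Dis n) j (Lower (Dis n) ?U)"
    using tU by (blast intro: greatest_lower_bound[OF U])
  have jmem: "j \<in> distinct_partitions n" "\<And>u. u \<in> ?U \<Longrightarrow> u \<succeq> j"
    using j U by (auto simp: greatest_def Lower_def Dis_def)
  have "z \<in> Lower (Dis n) ?U" if "z \<in> {c, d}" for z
    using that assms by (auto simp: Upper_def Lower_def Dis_def)
  then have "z \<sqsubseteq>\<^bsub>Dis n\<^esub> j" if "z \<in> {c, d}" for z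
    using greatest_le[OF j] that by blast
  then have "least (Dis n) j ?U"
    using jmem assms by (auto simp: least_def Upper_def Dis_def)
  moreover have "length t \<le> length j"
    using majorizes_length[OF jmem(1) t(1) jmem(2)[OF tU]] .
  ultimately show thesis using that s t(2) by simp
qed

lemma lattice_Dis:
  assumes "0 < n"
  shows "Lattice.lattice (Dis n)"
proof -
  interpret partial_order "Dis n" by (rule partial_order_Dis)
  show ?thesis
  proof
    show "\<exists>s. least (Dis n) s (Upper (Dis n) {x, y})"
      if "x \<in> carrier (Dis n)" "y \<in> carrier (Dis n)" for x y
      using that least_upper_bound[OF _ _ assms, of x y] by (auto simp: Dis_def)
    show "\<exists>s. greatest (Dis n) s (Lower (Dis n) {x, y})"
      if "x \<in> carrier (Dis n)" "y \<in> carrier (Dis n)" for x y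
      using that greatest_lower_bound[of "{x, y}" n] by (auto simp: Dis_def)
  qed
qed

lemma length_meet_Dis:
  assumes "c \<in> distinct_partitions n" "d \<in> distinct_partitions n"
  shows "length (c \<sqinter>\<^bsub>Dis n\<^esub> d) = max (length c) (length d)"
proof -
  obtain g where g: "greatest (Dis n) g (Lower (Dis n) {c, d})"
      "\<And>k. (\<And>x. x \<in> {c, d} \<Longrightarrow> length x \<le> k) \<Longrightarrow> length g \<le> k"
    using greatest_lower_bound[of "{c, d}" n] assms by auto
  have "length g \<le> max (length c) (length d)"
    by (rule g(2)) auto
  moreover have "g \<in> distinct_partitions n" "c \<succeq> g" "d \<succeq> g"
    using g(1) assms by (auto simp: greatest_Lower_pair Dis_def)
  ultimately have "length g = max (length c) (length d)"
    using majorizes_length[of g n] assms by (metis le_antisym max.bounded_iff)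
  then show ?thesis
    using partial_order.meet_eqI[OF partial_order_Dis g(1)] by simp
qed

lemma length_join_Dis:
  assumes "c \<in> distinct_partitions n" "d \<in> distinct_partitions n" "0 < n"
  shows "length (c \<squnion>\<^bsub>Dis n\<^esub> d) = min (length c) (length d)"
proof -
  obtain j where j: "least (Dis n) j (Upper (Dis n) {c, d})"
      "min (length c) (length d) \<le> length j"
    using least_upper_bound[OF assms] by blast
  have "j \<in> distinct_partitions n" "j \<succeq> c" "j \<succeq> d"
    using j(1) assms by (auto simp: least_Upper_pair Dis_def)
  then have "length j = min (length c) (length d)"
    using majorizes_length[of _ n j] assms j(2) by (metis le_antisym min.bounded_iff)
  then show ?thesis
    using partial_order.join_eqI[OF partial_order_Dis j(1)] by simp
qed

section \<open>Adjoining a bottom and a top element\<close>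

lemma partial_order_add_hats:
  assumes "partial_order P"
  shows "partial_order (add_hats P)"
proof -
  interpret P: partial_order P by (rule assms)
  have trans: "hat_le (le P) x z"
    if "hat_le (le P) x y" "hat_le (le P) y z"
      "x \<in> carrier (add_hats P)" "y \<in> carrier (add_hats P)" "z \<in> carrier (add_hats P)" for x y z
    using that by (cases x; cases y; cases z) (auto simp: add_hats_def intro: P.le_trans)
  show ?thesis
  proof
    show "x \<sqsubseteq>\<^bsub>add_hats P\<^esub> x" if "x \<in> carrier (add_hats P)" for x
      using that by (auto simp: add_hats_def)
    show "x .=\<^bsub>add_hats P\<^esub> y"
      if "x \<sqsubseteq>\<^bsub>add_hats P\<^esub> y" "y \<sqsubseteq>\<^bsub>add_hats P\<^esub> x"
        "x \<in> carrier (add_hats P)" "y \<in> carrier (add_hats P)" for x y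
      using that by (cases x; cases y) (auto simp: add_hats_def)
    show "x \<sqsubseteq>\<^bsub>add_hats P\<^esub> z"
      if "x \<sqsubseteq>\<^bsub>add_hats P\<^esub> y" "y \<sqsubseteq>\<^bsub>add_hats P\<^esub> z"
        "x \<in> carrier (add_hats P)" "y \<in> carrier (add_hats P)" "z \<in> carrier (add_hats P)" for x y z
      using that trans[of x y z] by (simp add: add_hats_def)
  qed (auto simp: add_hats_def)
qed

lemma greatest_add_hats_Elem:
  assumes "greatest P m (Lower P {x, y})" "x \<in> carrier P" "y \<in> carrier P"
  shows "greatest (add_hats P) (Elem m) (Lower (add_hats P) {Elem x, Elem y})"
  using assms by (auto simp: greatest_Lower_pair add_hats_def)

lemma greatest_add_hats_Zero:
  assumes "Lower P {x, y} = {}" "x \<in> carrier P" "y \<in> carrier P"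
  shows "greatest (add_hats P) Zero_hat (Lower (add_hats P) {Elem x, Elem y})"
  using assms(2,3) assms(1)[unfolded Lower_pair[OF assms(2,3)]]
  by (auto simp: greatest_Lower_pair add_hats_def)

lemma least_add_hats_Elem:
  assumes "least P j (Upper P {x, y})" "x \<in> carrier P" "y \<in> carrier P"
  shows "least (add_hats P) (Elem j) (Upper (add_hats P) {Elem x, Elem y})"
  using assms by (auto simp: least_Upper_pair add_hats_def)

lemma least_add_hats_One:
  assumes "Upper P {x, y} = {}" "x \<in> carrier P" "y \<in> carrier P"
  shows "least (add_hats P) One_hat (Upper (add_hats P) {Elem x, Elem y})"
  using assms(2,3) assms(1)[unfolded Upper_pair[OF assms(2,3)]]
  by (auto simp: least_Upper_pair add_hats_def)

text \<open>If two elements have no common lower bound, the new bottom is their meet, so it is enough that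
  bounded pairs have meets and joins. Pairs involving a new element are comparable.\<close>

lemma lattice_add_hats:
  assumes "partial_order P"
    and meets: "\<And>x y. x \<in> carrier P \<Longrightarrow> y \<in> carrier P \<Longrightarrow> Lower P {x, y} \<noteq> {} \<Longrightarrow>
      \<exists>m. greatest P m (Lower P {x, y})"
    and joins: "\<And>x y. x \<in> carrier P \<Longrightarrow> y \<in> carrier P \<Longrightarrow> Upper P {x, y} \<noteq> {} \<Longrightarrow>
      \<exists>j. least P j (Upper P {x, y})"
  shows "Lattice.lattice (add_hats P)"
proof -
  note po = partial_order_add_hats[OF assms(1)]
  interpret partial_order "add_hats P" by (rule po)
  have meet_exists: "\<exists>m. greatest (add_hats P) m (Lower (add_hats P) {x, y})"
    if "x \<in> carrier (add_hats P)" "y \<in> carrier (add_hats P)" for x y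
  proof (cases "x \<sqsubseteq>\<^bsub>add_hats P\<^esub> y \<or> y \<sqsubseteq>\<^bsub>add_hats P\<^esub> x")
    case True
    then show ?thesis using that by (auto simp: greatest_Lower_pair)
  next
    case False
    with that obtain a b where "x = Elem a" "y = Elem b" "a \<in> carrier P" "b \<in> carrier P"
      by (cases x; cases y) (auto simp: add_hats_def)
    then show ?thesis
      using greatest_add_hats_Elem[of P _ a b] greatest_add_hats_Zero[of P a b] meets[of a b] by blast
  qed
  have join_exists: "\<exists>j. least (add_hats P) j (Upper (add_hats P) {x, y})"
    if "x \<in> carrier (add_hats P)" "y \<in> carrier (add_hats P)" for x y
  proof (cases "x \<sqsubseteq>\<^bsub>add_hats P\<^esub> y \<or> y \<sqsubseteq>\<^bsub>add_hats P\<^esub> x")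
    case True
    then show ?thesis using that by (auto simp: least_Upper_pair)
  next
    case False
    with that obtain a b where "x = Elem a" "y = Elem b" "a \<in> carrier P" "b \<in> carrier P"
      by (cases x; cases y) (auto simp: add_hats_def)
    then show ?thesis
      using least_add_hats_Elem[of P _ a b] least_add_hats_One[of P a b] joins[of a b] by blast
  qed
  show ?thesis
    by standard (use meet_exists join_exists in blast)+
qed

section \<open>Meets and joins of blocks\<close>

lemma partial_order_S_Block: "partial_order (S_Block n)"
proof
  interpret Dis: partial_order "Dis n" by (rule partial_order_Dis)
  show "x .=\<^bsub>S_Block n\<^esub> y"
    if "x \<sqsubseteq>\<^bsub>S_Block n\<^esub> y" "y \<sqsubseteq>\<^bsub>S_Block n\<^esub> x" "x \<in> carrier (S_Block n)" "y \<in> carrier (S_Block n)" for x y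
    using that Dis.le_antisym[of "fst x" "fst y"] Dis.le_antisym[of "snd x" "snd y"]
    by (auto simp: S_Block_def S_blocks_def Dis_def)
  show "x \<sqsubseteq>\<^bsub>S_Block n\<^esub> x" for x
    by (simp add: S_Block_def majorizes_def split: prod.split)
  show "x \<sqsubseteq>\<^bsub>S_Block n\<^esub> z"
    if "x \<sqsubseteq>\<^bsub>S_Block n\<^esub> y" "y \<sqsubseteq>\<^bsub>S_Block n\<^esub> z"
      "x \<in> carrier (S_Block n)" "y \<in> carrier (S_Block n)" "z \<in> carrier (S_Block n)" for x y z
    using that majorizes_trans[of "fst x" n "fst y" "fst z"] majorizes_trans[of "snd z" n "snd y" "snd x"]
    by (auto simp: S_Block_def S_blocks_def)
qed (auto simp: S_Block_def)

text \<open>The meet and join of the lattice in terms of majorization, for use with the two components of a block.\<close>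

lemma meet_Dis:
  assumes "c \<in> distinct_partitions n" "d \<in> distinct_partitions n" "0 < n"
  shows "c \<sqinter>\<^bsub>Dis n\<^esub> d \<in> distinct_partitions n" "c \<succeq> c \<sqinter>\<^bsub>Dis n\<^esub> d" "d \<succeq> c \<sqinter>\<^bsub>Dis n\<^esub> d"
    "\<And>z. z \<in> distinct_partitions n \<Longrightarrow> c \<succeq> z \<Longrightarrow> d \<succeq> z \<Longrightarrow> c \<sqinter>\<^bsub>Dis n\<^esub> d \<succeq> z"
proof -
  interpret lattice "Dis n" by (rule lattice_Dis[OF assms(3)])
  show "c \<sqinter>\<^bsub>Dis n\<^esub> d \<in> distinct_partitions n" "c \<succeq> c \<sqinter>\<^bsub>Dis n\<^esub> d" "d \<succeq> c \<sqinter>\<^bsub>Dis n\<^esub> d"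
    "\<And>z. z \<in> distinct_partitions n \<Longrightarrow> c \<succeq> z \<Longrightarrow> d \<succeq> z \<Longrightarrow> c \<sqinter>\<^bsub>Dis n\<^esub> d \<succeq> z"
    using meet_closed[of c d] meet_left[of c d] meet_right[of c d] meet_le[of _ c d] assms
    by (simp_all add: Dis_def)
qed

lemma join_Dis:
  assumes "c \<in> distinct_partitions n" "d \<in> distinct_partitions n" "0 < n"
  shows "c \<squnion>\<^bsub>Dis n\<^esub> d \<in> distinct_partitions n" "c \<squnion>\<^bsub>Dis n\<^esub> d \<succeq> c" "c \<squnion>\<^bsub>Dis n\<^esub> d \<succeq> d"
    "\<And>z. z \<in> distinct_partitions n \<Longrightarrow> z \<succeq> c \<Longrightarrow> z \<succeq> d \<Longrightarrow> z \<succeq> c \<squnion>\<^bsub>Dis n\<^esub> d"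
proof -
  interpret lattice "Dis n" by (rule lattice_Dis[OF assms(3)])
  show "c \<squnion>\<^bsub>Dis n\<^esub> d \<in> distinct_partitions n" "c \<squnion>\<^bsub>Dis n\<^esub> d \<succeq> c" "c \<squnion>\<^bsub>Dis n\<^esub> d \<succeq> d"
    "\<And>z. z \<in> distinct_partitions n \<Longrightarrow> z \<succeq> c \<Longrightarrow> z \<succeq> d \<Longrightarrow> z \<succeq> c \<squnion>\<^bsub>Dis n\<^esub> d"
    using join_closed[of c d] join_left[of c d] join_right[of c d] join_le[of c _ d] assms
    by (simp_all add: Dis_def)
qed

text \<open>The majorization required of the block is \<open>b1 \<squnion> b2 \<succeq> b1 \<succeq> a1 \<succeq> a1 \<sqinter> a2\<close>. The
  length condition is the only obstacle: the length difference of this pair is the largest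
  \<open>length a\<^sub>i - length b\<^sub>j\<close>, and the two mixed differences are bounded by hypothesis.\<close>

lemma greatest_S_Block:
  assumes x: "(a1, b1) \<in> S_blocks n" and y: "(a2, b2) \<in> S_blocks n" and n: "0 < n"
    and len: "length a1 \<le> length b2 + 1" "length a2 \<le> length b1 + 1"
  shows "greatest (S_Block n) (a1 \<sqinter>\<^bsub>Dis n\<^esub> a2, b1 \<squnion>\<^bsub>Dis n\<^esub> b2) (Lower (S_Block n) {(a1, b1), (a2, b2)})"
proof -
  let ?a = "a1 \<sqinter>\<^bsub>Dis n\<^esub> a2" and ?b = "b1 \<squnion>\<^bsub>Dis n\<^esub> b2"
  note blocks = x[unfolded S_blocks_def, simplified] y[unfolded S_blocks_def, simplified]
  have a: "a1 \<in> distinct_partitions n" "a2 \<in> distinct_partitions n" using blocks by auto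
  have b: "b1 \<in> distinct_partitions n" "b2 \<in> distinct_partitions n" using blocks by auto
  note meet = meet_Dis[OF a n] and join = join_Dis[OF b n]
  have "b1 \<succeq> ?a"
    using majorizes_trans[OF meet(1) a(1) b(1)] meet(2) blocks by simp
  then have maj: "?b \<succeq> ?a"
    using majorizes_trans[OF meet(1) b(1) join(1)] join(2) by simp
  have "length ?a \<in> {length ?b, length ?b + 1}"
    using length_meet_Dis[OF a] length_join_Dis[OF b n] len blocks by (auto simp: max_def min_def)
  with maj meet(1) join(1) have "(?a, ?b) \<in> S_blocks n" by (simp add: S_blocks_def)
  then show ?thesis
    using x y meet join by (auto simp: greatest_Lower_pair S_Block_def S_blocks_def)
qed

text \<open>A lower bound \<open>[a | b]\<close> has \<open>a\<close> at least as long as both \<open>a\<^sub>i\<close> and \<open>b\<close> at most as long as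
  both \<open>b\<^sub>j\<close>, so the mixed differences are at most \<open>length a - length b \<le> 1\<close>.\<close>

lemma Lower_S_Block_length:
  assumes x: "(a1, b1) \<in> S_blocks n" and y: "(a2, b2) \<in> S_blocks n"
    and z: "z \<in> Lower (S_Block n) {(a1, b1), (a2, b2)}"
  shows "length a1 \<le> length b2 + 1" "length a2 \<le> length b1 + 1"
proof -
  obtain a b where ab: "z = (a, b)" by (cases z)
  have "(a, b) \<in> S_blocks n" "a1 \<succeq> a" "a2 \<succeq> a" "b \<succeq> b1" "b \<succeq> b2"
    using z x y ab by (auto simp: Lower_pair S_Block_def)
  then have "length a1 \<le> length a" "length a2 \<le> length a" "length b \<le> length b1" "length b \<le> length b2"
      "length a \<le> length b + 1"
    using x y majorizes_length[of _ n] by (auto simp: S_blocks_def)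
  then show "length a1 \<le> length b2 + 1" "length a2 \<le> length b1 + 1" by auto
qed

text \<open>Here the length condition is automatic: the difference is at most
  \<open>length a1 - length b1 \<le> 1\<close>, and it is nonnegative because a majorizing partition is never
  the longer one.\<close>

lemma least_S_Block:
  assumes x: "(a1, b1) \<in> S_blocks n" and y: "(a2, b2) \<in> S_blocks n" and n: "0 < n"
    and maj: "b1 \<sqinter>\<^bsub>Dis n\<^esub> b2 \<succeq> a1 \<squnion>\<^bsub>Dis n\<^esub> a2"
  shows "least (S_Block n) (a1 \<squnion>\<^bsub>Dis n\<^esub> a2, b1 \<sqinter>\<^bsub>Dis n\<^esub> b2) (Upper (S_Block n) {(a1, b1), (a2, b2)})"
proof -
  let ?a = "a1 \<squnion>\<^bsub>Dis n\<^esub> a2" and ?b = "b1 \<sqinter>\<^bsub>Dis n\<^esub> b2"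
  note blocks = x[unfolded S_blocks_def, simplified] y[unfolded S_blocks_def, simplified]
  have a: "a1 \<in> distinct_partitions n" "a2 \<in> distinct_partitions n" using blocks by auto
  have b: "b1 \<in> distinct_partitions n" "b2 \<in> distinct_partitions n" using blocks by auto
  note join = join_Dis[OF a n] and meet = meet_Dis[OF b n]
  have "length ?b \<le> length ?a"
    using majorizes_length[OF join(1) meet(1) maj] .
  then have "length ?a \<in> {length ?b, length ?b + 1}"
    using length_meet_Dis[OF b] length_join_Dis[OF a n] blocks by (auto simp: max_def min_def split: if_splits)
  with maj meet(1) join(1) have "(?a, ?b) \<in> S_blocks n" by (simp add: S_blocks_def)
  then show ?thesis
    using x y meet join by (auto simp: least_Upper_pair S_Block_def S_blocks_def)
qed

text \<open>An upper bound \<open>[a | b]\<close> gives \<open>b1 \<sqinter> b2 \<succeq> b \<succeq> a \<succeq> a1 \<squnion> a2\<close>.\<close>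

lemma Upper_S_Block_majorizes:
  assumes x: "(a1, b1) \<in> S_blocks n" and y: "(a2, b2) \<in> S_blocks n" and n: "0 < n"
    and z: "z \<in> Upper (S_Block n) {(a1, b1), (a2, b2)}"
  shows "b1 \<sqinter>\<^bsub>Dis n\<^esub> b2 \<succeq> a1 \<squnion>\<^bsub>Dis n\<^esub> a2"
proof -
  obtain a b where ab: "z = (a, b)" by (cases z)
  have a: "a1 \<in> distinct_partitions n" "a2 \<in> distinct_partitions n"
    and b: "b1 \<in> distinct_partitions n" "b2 \<in> distinct_partitions n"
    using x y by (auto simp: S_blocks_def)
  note join = join_Dis[OF a n] and meet = meet_Dis[OF b n]
  have z': "a \<in> distinct_partitions n" "b \<in> distinct_partitions n" "b \<succeq> a"
      "a \<succeq> a1" "a \<succeq> a2" "b1 \<succeq> b" "b2 \<succeq> b"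
    using z x y ab by (auto simp: Upper_pair S_Block_def S_blocks_def)
  have "b \<succeq> a1 \<squnion>\<^bsub>Dis n\<^esub> a2"
    using majorizes_trans[OF join(1) z'(1,2,3) join(4)] z' by simp
  then show ?thesis
    using majorizes_trans[OF join(1) z'(2) meet(1) meet(4)] z' by simp
qed

theorem theorem5p1:
  fixes n :: nat
  assumes "n > 0"
  shows "Lattice.lattice (add_hats (S_Block n)) \<and>
    (\<forall>\<alpha>1 \<beta>1 \<alpha>2 \<beta>2. (\<alpha>1, \<beta>1) \<in> carrier (S_Block n) \<longrightarrow> (\<alpha>2, \<beta>2) \<in> carrier (S_Block n) \<longrightarrow>
      (let l = max (int (length \<alpha>1) - int (length \<beta>2)) (int (length \<alpha>2) - int (length \<beta>1));
           mt = Elem (\<alpha>1, \<beta>1) \<sqinter>\<^bsub>add_hats (S_Block n)\<^esub> Elem (\<alpha>2, \<beta>2);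
           jn = Elem (\<alpha>1, \<beta>1) \<squnion>\<^bsub>add_hats (S_Block n)\<^esub> Elem (\<alpha>2, \<beta>2);
           am = \<alpha>1 \<sqinter>\<^bsub>Dis n\<^esub> \<alpha>2; aj = \<alpha>1 \<squnion>\<^bsub>Dis n\<^esub> \<alpha>2;
           bm = \<beta>1 \<sqinter>\<^bsub>Dis n\<^esub> \<beta>2; bj = \<beta>1 \<squnion>\<^bsub>Dis n\<^esub> \<beta>2
       in (if l = 0 \<or> l = 1
           then mt = Elem (am, bj) \<and> (am, bj) \<in> carrier (S_Block n)
           else mt = Zero_hat) \<and>
          (if bm \<succeq> aj
           then jn = Elem (aj, bm) \<and> (aj, bm) \<in> carrier (S_Block n)
           else jn = One_hat)))"
proof -
  note po = partial_order_S_Block[of n]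
  interpret hat: partial_order "add_hats (S_Block n)" by (rule partial_order_add_hats[OF po])
  have carrier: "carrier (S_Block n) = S_blocks n" by (simp add: S_Block_def)
  have "Lattice.lattice (add_hats (S_Block n))"
  proof (rule lattice_add_hats[OF po])
    fix x y assume xy: "x \<in> carrier (S_Block n)" "y \<in> carrier (S_Block n)"
    obtain a1 b1 a2 b2 where eq: "x = (a1, b1)" "y = (a2, b2)" by (cases x, cases y)
    note blocks = xy[unfolded carrier eq]
    show "\<exists>m. greatest (S_Block n) m (Lower (S_Block n) {x, y})" if "Lower (S_Block n) {x, y} \<noteq> {}"
      using that greatest_S_Block[OF blocks assms] Lower_S_Block_length[OF blocks] unfolding eq by blast
    show "\<exists>j. least (S_Block n) j (Upper (S_Block n) {x, y})" if "Upper (S_Block n) {x, y} \<noteq> {}"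
      using that least_S_Block[OF blocks assms] Upper_S_Block_majorizes[OF blocks assms] unfolding eq by blast
  qed
  moreover have
    "(let l = max (int (length a1) - int (length b2)) (int (length a2) - int (length b1));
          mt = Elem (a1, b1) \<sqinter>\<^bsub>add_hats (S_Block n)\<^esub> Elem (a2, b2);
          jn = Elem (a1, b1) \<squnion>\<^bsub>add_hats (S_Block n)\<^esub> Elem (a2, b2);
          am = a1 \<sqinter>\<^bsub>Dis n\<^esub> a2; aj = a1 \<squnion>\<^bsub>Dis n\<^esub> a2;
          bm = b1 \<sqinter>\<^bsub>Dis n\<^esub> b2; bj = b1 \<squnion>\<^bsub>Dis n\<^esub> b2
      in (if l = 0 \<or> l = 1
          then mt = Elem (am, bj) \<and> (am, bj) \<in> carrier (S_Block n)
          else mt = Zero_hat) \<and>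
         (if bm \<succeq> aj
          then jn = Elem (aj, bm) \<and> (aj, bm) \<in> carrier (S_Block n)
          else jn = One_hat))"
    if xy: "(a1, b1) \<in> carrier (S_Block n)" "(a2, b2) \<in> carrier (S_Block n)" for a1 b1 a2 b2
  proof -
    note blocks = xy[unfolded carrier]
    define l where "l = max (int (length a1) - int (length b2)) (int (length a2) - int (length b1))"
    \<comment> \<open>\<open>l\<close> is never negative: otherwise
          \<open>length a1 < length b2 \<le> length a2 < length b1 \<le> length a1\<close>.\<close>
    have l_iff: "l = 0 \<or> l = 1 \<longleftrightarrow> length a1 \<le> length b2 + 1 \<and> length a2 \<le> length b1 + 1"
      using blocks by (auto simp: l_def S_blocks_def max_def)
    have meet: "if l = 0 \<or> l = 1
        then Elem (a1, b1) \<sqinter>\<^bsub>add_hats (S_Block n)\<^esub> Elem (a2, b2) = Elem (a1 \<sqinter>\<^bsub>Dis n\<^esub> a2, b1 \<squnion>\<^bsub>Dis n\<^esub> b2) \<and>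
          (a1 \<sqinter>\<^bsub>Dis n\<^esub> a2, b1 \<squnion>\<^bsub>Dis n\<^esub> b2) \<in> carrier (S_Block n)
        else Elem (a1, b1) \<sqinter>\<^bsub>add_hats (S_Block n)\<^esub> Elem (a2, b2) = Zero_hat"
    proof (cases "l = 0 \<or> l = 1")
      case True
      then have g: "greatest (S_Block n) (a1 \<sqinter>\<^bsub>Dis n\<^esub> a2, b1 \<squnion>\<^bsub>Dis n\<^esub> b2)
          (Lower (S_Block n) {(a1, b1), (a2, b2)})"
        using greatest_S_Block[OF blocks assms] l_iff by blast
      show ?thesis
        using True hat.meet_eqI[OF greatest_add_hats_Elem[OF g xy]] greatest_closed[OF g] by simp
    next
      case False
      then have "Lower (S_Block n) {(a1, b1), (a2, b2)} = {}"
        using Lower_S_Block_length[OF blocks] l_iff by blast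
      with False show ?thesis
        using hat.meet_eqI[OF greatest_add_hats_Zero[OF _ xy]] by simp
    qed
    have join: "if b1 \<sqinter>\<^bsub>Dis n\<^esub> b2 \<succeq> a1 \<squnion>\<^bsub>Dis n\<^esub> a2
        then Elem (a1, b1) \<squnion>\<^bsub>add_hats (S_Block n)\<^esub> Elem (a2, b2) = Elem (a1 \<squnion>\<^bsub>Dis n\<^esub> a2, b1 \<sqinter>\<^bsub>Dis n\<^esub> b2) \<and>
          (a1 \<squnion>\<^bsub>Dis n\<^esub> a2, b1 \<sqinter>\<^bsub>Dis n\<^esub> b2) \<in> carrier (S_Block n)
        else Elem (a1, b1) \<squnion>\<^bsub>add_hats (S_Block n)\<^esub> Elem (a2, b2) = One_hat"
    proof (cases "b1 \<sqinter>\<^bsub>Dis n\<^esub> b2 \<succeq> a1 \<squnion>\<^bsub>Dis n\<^esub> a2")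
      case True
      note j = least_S_Block[OF blocks assms True]
      show ?thesis
        using True hat.join_eqI[OF least_add_hats_Elem[OF j xy]] least_closed[OF j] by simp
    next
      case False
      then have "Upper (S_Block n) {(a1, b1), (a2, b2)} = {}"
        using Upper_S_Block_majorizes[OF blocks assms] by blast
      with False show ?thesis
        using hat.join_eqI[OF least_add_hats_One[OF _ xy]] by simp
    qed
    show ?thesis
      unfolding Let_def l_def[symmetric] using meet join by (rule conjI)
  qed
  ultimately show ?thesis by blast
qed

end
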